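(* Let $\mathbb{K}$ be a field. The set of all $\mathfrak{I}$-specific elimination vectors of a polynomial ideal $\mathfrak{I}$ is in general not convex: there exist $n,m\ge 1$ and an ideal $\mathfrak{I}\subseteq\mathbb{K}[x_1,\ldots,x_n,u_1,\ldots,u_m]$ such that the union of the Gröbner cones $C_\prec(\mathfrak{I})$ over all $\mathfrak{I}$-specific elimination orders $\prec$ for the elimination of $u_1,\ldots,u_m$ is not a convex subset of $\mathbb{R}^{n+m}$.
   Context: Write $\mathbb{K}[X]=\mathbb{K}[x_1,\ldots,x_n]$, $\mathbb{K}[X][U]=\mathbb{K}[x_1,\ldots,x_n,u_1,\ldots,u_m]$, and $(y_1,\ldots,y_{n+m})=(x_1,\ldots,x_n,u_1,\ldots,u_m)$; for $\alpha\in\mathbb{N}^{n+m}$ put $y^\alpha=\prod_i y_i^{\alpha_i}$. For a monomial order $\prec$ on $\mathbb{K}[X][U]$, $\mathrm{lt}_\prec(f)$ is the leading term of $f\neq 0$, and $\langle \mathrm{lt}_\prec(\mathfrak{I})\rangle$ is the ideal generated by all leading terms of nonzero elements of $\mathfrak{I}$. A Gröbner basis $G$ is reduced if for all $g\ne h$ in $G$, $\mathrm{lt}_\prec(g)$ divides no monomial of $h$; it is normed if all leading coefficients are $1$. $\underline{GB}(\mathfrak{I},\prec)$ denotes the unique finite normed reduced Gröbner basis of $\mathfrak{I}$ with respect to $\prec$. Weight vectors are the elements of $\Omega:=\mathbb{R}^{n+m}_{\ge 0}$. For $f=\sum_\alpha f_\alpha y^\alpha\ne 0$ and $\omega\in\Omega$,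 $\deg_\omega(f):=\max\{\omega^T\alpha : f_\alpha\ne0\}$, and $\mathrm{lt}_\omega(f):=\sum_{\alpha\in A} f_\alpha y^\alpha$ with $A=\{\alpha\in\mathbb{N}^{n+m}: f_\alpha\neq 0,\ \omega^T\alpha=\deg_\omega(f)\}$. $\langle\mathrm{lt}_\omega(\mathfrak{I})\rangle$ is the ideal generated by all $\mathrm{lt}_\omega(f)$, $0\neq f\in\mathfrak{I}$. The Gröbner cone of $\mathfrak{I}$ with respect to $\prec$ is $C_\prec(\mathfrak{I}):=\mathrm{closure}(\{\omega\in\Omega : \langle\mathrm{lt}_\omega(\mathfrak{I})\rangle=\langle\mathrm{lt}_\prec(\mathfrak{I})\rangle\})$, closure in the standard topology of $\mathbb{R}^{n+m}$. A monomial order $\prec$ is an $\mathfrak{I}$-specific elimination order for the elimination of $u_1,\ldots,u_m$ if for all $g\in\underline{GB}(\mathfrak{I},\prec)$: $\mathrm{lt}_\prec(g)\in\mathbb{K}[X]$ implies $g\in\mathbb{K}[X]$. A vector $\omega\in\Omega$ is an $\mathfrak{I}$-specific elimination vector if $\omega\in C_\prec(\mathfrak{I})$ for some such order $\prec$. *)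

theory Defs
  imports
    "HOL-Analysis.Analysis"
    "HOL-Algebra.Ideal"
    "HOL-Library.Poly_Mapping"
begin

text \<open>
  A monomial is its exponent vector, a finitely supported map from variable indices to \<open>nat\<close>;
  a polynomial maps monomials to coefficients. In \<open>K[x\<^sub>1,\<dots>,x\<^sub>n,u\<^sub>1,\<dots>,u\<^sub>m]\<close> the variable \<open>x\<^sub>i\<close> has
  index \<open>i - 1\<close> and \<open>u\<^sub>j\<close> has index \<open>n + j - 1\<close>, so that \<open>K[X]\<close> is literally a subset of \<open>K[X][U]\<close>.
\<close>

type_synonym mon = "nat \<Rightarrow>\<^sub>0 nat"
type_synonym 'k mpoly = "mon \<Rightarrow>\<^sub>0 'k"

definition mons :: "nat \<Rightarrow> mon set" where
  "mons N = {t. Poly_Mapping.keys t \<subseteq> {..<N}}"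

definition mpolys :: "nat \<Rightarrow> 'k::zero mpoly set" where
  "mpolys N = {p. Poly_Mapping.keys p \<subseteq> mons N}"

definition mpoly_ring :: "nat \<Rightarrow> 'k::field mpoly ring" where
  "mpoly_ring N = \<lparr>carrier = mpolys N, mult = (*), one = 1, zero = 0, add = (+)\<rparr>"

lemma cring_mpoly_ring: "cring (mpoly_ring N :: 'k::field mpoly ring)"
proof -
  have add: "p + q \<in> mpolys N" if "p \<in> mpolys N" "q \<in> mpolys N" for p q :: "'k mpoly"
    using that Poly_Mapping.keys_add[of p q] by (auto simp: mpolys_def)
  have mult: "p * q \<in> mpolys N" if "p \<in> mpolys N" "q \<in> mpolys N" for p q :: "'k mpoly"
  proof -
    have "s + t \<in> mons N" if "s \<in> mons N" "t \<in> mons N" for s t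
      using that Poly_Mapping.keys_add[of s t] by (auto simp: mons_def)
    then show ?thesis
      using that Poly_Mapping.keys_mult[of p q] by (fastforce simp: mpolys_def)
  qed
  have uminus: "- p \<in> mpolys N" if "p \<in> mpolys N" for p :: "'k mpoly"
    using that by (simp add: mpolys_def)
  have one: "(1 :: 'k mpoly) \<in> mpolys N"
    by (simp add: mpolys_def mons_def)
  show ?thesis
  proof (rule cringI)
    show "abelian_group (mpoly_ring N :: 'k mpoly ring)"
    proof (rule abelian_groupI)
      fix p :: "'k mpoly" assume "p \<in> carrier (mpoly_ring N)"
      then show "\<exists>q\<in>carrier (mpoly_ring N). q \<oplus>\<^bsub>mpoly_ring N\<^esub> p = \<zero>\<^bsub>mpoly_ring N\<^esub>"
        by (intro bexI[of _ "- p"]) (auto simp: mpoly_ring_def uminus)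
    qed (auto simp: mpoly_ring_def add algebra_simps, simp add: mpolys_def)
    show "comm_monoid (mpoly_ring N :: 'k mpoly ring)"
      by (rule comm_monoidI) (auto simp: mpoly_ring_def mult one algebra_simps)
  qed (auto simp: mpoly_ring_def algebra_simps)
qed

text \<open>
  A monomial order is only constrained on \<open>mons N\<close>; for an ideal of \<open>mpoly_ring N\<close> nothing below
  depends on its values elsewhere. A total multiplicative order with least element \<open>1\<close> (exponent
  vector \<open>0\<close>) on \<open>mons N\<close> is a well-order by Dickson's lemma.
\<close>

definition monomial_order :: "nat \<Rightarrow> (mon \<Rightarrow> mon \<Rightarrow> bool) \<Rightarrow> bool" where
  "monomial_order N prec \<longleftrightarrow>
     irreflp_on (mons N) prec \<and> transp_on (mons N) prec \<and> totalp_on (mons N) prec \<and>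
     (\<forall>r\<in>mons N. \<forall>s\<in>mons N. \<forall>t\<in>mons N. prec s t \<longrightarrow> prec (s + r) (t + r)) \<and>
     (\<forall>t\<in>mons N. t \<noteq> 0 \<longrightarrow> prec 0 t)"

definition lead_mon :: "(mon \<Rightarrow> mon \<Rightarrow> bool) \<Rightarrow> 'k::zero mpoly \<Rightarrow> mon" where
  "lead_mon prec f =
     (THE t. t \<in> Poly_Mapping.keys f \<and> (\<forall>s\<in>Poly_Mapping.keys f. s \<noteq> t \<longrightarrow> prec s t))"

definition lead_coeff :: "(mon \<Rightarrow> mon \<Rightarrow> bool) \<Rightarrow> 'k::zero mpoly \<Rightarrow> 'k" where
  "lead_coeff prec f = Poly_Mapping.lookup f (lead_mon prec f)"

definition lead_term :: "(mon \<Rightarrow> mon \<Rightarrow> bool) \<Rightarrow> 'k::zero mpoly \<Rightarrow> 'k mpoly" where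
  "lead_term prec f = Poly_Mapping.single (lead_mon prec f) (lead_coeff prec f)"

definition initial_ideal :: "nat \<Rightarrow> (mon \<Rightarrow> mon \<Rightarrow> bool) \<Rightarrow> 'k::field mpoly set \<Rightarrow> 'k mpoly set" where
  "initial_ideal N prec I = Idl\<^bsub>mpoly_ring N\<^esub> (lead_term prec ` (I - {0}))"

definition groebner_basis ::
    "nat \<Rightarrow> (mon \<Rightarrow> mon \<Rightarrow> bool) \<Rightarrow> 'k::field mpoly set \<Rightarrow> 'k mpoly set \<Rightarrow> bool" where
  "groebner_basis N prec I G \<longleftrightarrow>
     finite G \<and> G \<subseteq> I - {0} \<and> Idl\<^bsub>mpoly_ring N\<^esub> (lead_term prec ` G) = initial_ideal N prec I"

text \<open>
  Divisibility is taken in the polynomial ring in countably many variables; between terms of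
  \<open>mpoly_ring N\<close> it agrees with divisibility in that subring.
\<close>

definition reduced :: "(mon \<Rightarrow> mon \<Rightarrow> bool) \<Rightarrow> 'k::field mpoly set \<Rightarrow> bool" where
  "reduced prec G \<longleftrightarrow>
     (\<forall>g\<in>G. \<forall>h\<in>G. g \<noteq> h \<longrightarrow>
        (\<forall>t\<in>Poly_Mapping.keys h. \<not> lead_term prec g dvd Poly_Mapping.single t 1))"

definition normed :: "(mon \<Rightarrow> mon \<Rightarrow> bool) \<Rightarrow> 'k::field mpoly set \<Rightarrow> bool" where
  "normed prec G \<longleftrightarrow> (\<forall>g\<in>G. lead_coeff prec g = 1)"

definition GB :: "nat \<Rightarrow> (mon \<Rightarrow> mon \<Rightarrow> bool) \<Rightarrow> 'k::field mpoly set \<Rightarrow> 'k mpoly set" where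
  "GB N prec I = (THE G. groebner_basis N prec I G \<and> reduced prec G \<and> normed prec G)"

text \<open>
  As in \<^const>\<open>Euclidean_space\<close>, a vector of \<open>\<real>\<^sup>N\<close> is a function on \<open>nat\<close> vanishing from index \<open>N\<close> on.
\<close>

definition weights :: "nat \<Rightarrow> (nat \<Rightarrow> real) set" where
  "weights N = {\<omega> \<in> topspace (Euclidean_space N). \<forall>i<N. 0 \<le> \<omega> i}"

definition mon_weight :: "nat \<Rightarrow> (nat \<Rightarrow> real) \<Rightarrow> mon \<Rightarrow> real" where
  "mon_weight N \<omega> t = (\<Sum>i<N. \<omega> i * real (Poly_Mapping.lookup t i))"

definition weight_deg :: "nat \<Rightarrow> (nat \<Rightarrow> real) \<Rightarrow> 'k::zero mpoly \<Rightarrow> real" where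
  "weight_deg N \<omega> f = Max (mon_weight N \<omega> ` Poly_Mapping.keys f)"

definition weight_lead :: "nat \<Rightarrow> (nat \<Rightarrow> real) \<Rightarrow> 'k::comm_monoid_add mpoly \<Rightarrow> 'k mpoly" where
  "weight_lead N \<omega> f =
     (\<Sum>t\<in>{t \<in> Poly_Mapping.keys f. mon_weight N \<omega> t = weight_deg N \<omega> f}.
        Poly_Mapping.single t (Poly_Mapping.lookup f t))"

definition weight_initial_ideal ::
    "nat \<Rightarrow> (nat \<Rightarrow> real) \<Rightarrow> 'k::field mpoly set \<Rightarrow> 'k mpoly set" where
  "weight_initial_ideal N \<omega> I = Idl\<^bsub>mpoly_ring N\<^esub> (weight_lead N \<omega> ` (I - {0}))"

definition groebner_cone ::
    "nat \<Rightarrow> (mon \<Rightarrow> mon \<Rightarrow> bool) \<Rightarrow> 'k::field mpoly set \<Rightarrow> (nat \<Rightarrow> real) set" where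
  "groebner_cone N prec I =
     Euclidean_space N closure_of
       {\<omega> \<in> weights N. weight_initial_ideal N \<omega> I = initial_ideal N prec I}"

definition elim_order ::
    "nat \<Rightarrow> nat \<Rightarrow> 'k::field mpoly set \<Rightarrow> (mon \<Rightarrow> mon \<Rightarrow> bool) \<Rightarrow> bool" where
  "elim_order n m I prec \<longleftrightarrow>
     monomial_order (n + m) prec \<and>
     (\<forall>g\<in>GB (n + m) prec I. lead_term prec g \<in> mpolys n \<longrightarrow> g \<in> mpolys n)"

definition elim_vectors :: "nat \<Rightarrow> nat \<Rightarrow> 'k::field mpoly set \<Rightarrow> (nat \<Rightarrow> real) set" where
  "elim_vectors n m I =
     {\<omega> \<in> weights (n + m). \<exists>prec. elim_order n m I prec \<and> \<omega> \<in> groebner_cone (n + m) prec I}"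

lemma closedin_weights: "closedin (Euclidean_space N) (weights N)"
proof -
  have "closed {\<omega> :: nat \<Rightarrow> real. \<forall>i<N. 0 \<le> \<omega> i}"
    by (intro closed_Collect_all closed_Collect_imp closed_Collect_le
        continuous_on_const continuous_on_product_coordinates) auto
  then have "closedin (powertop_real UNIV) {\<omega> :: nat \<Rightarrow> real. \<forall>i<N. 0 \<le> \<omega> i}"
    by (simp add: euclidean_product_topology)
  then show ?thesis
    unfolding Euclidean_space_def closedin_subtopology weights_def by auto
qed

lemma elim_vectors_eq_Union:
  "elim_vectors n m I = (\<Union>prec\<in>{prec. elim_order n m I prec}. groebner_cone (n + m) prec I)"
proof -
  have "groebner_cone (n + m) prec I \<subseteq> weights (n + m)" for prec
    unfolding groebner_cone_def
    by (rule closure_of_minimal[OF _ closedin_weights]) auto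
  then show ?thesis
    by (fastforce simp: elim_vectors_def)
qed

text \<open>
  The body of \<^const>\<open>convex\<close>, spelled out because \<open>nat \<Rightarrow> real\<close> is no instance of \<^class>\<open>real_vector\<close>.
\<close>

definition convex_fun :: "(nat \<Rightarrow> real) set \<Rightarrow> bool" where
  "convex_fun S \<longleftrightarrow>
     (\<forall>x\<in>S. \<forall>y\<in>S. \<forall>u\<ge>0. \<forall>v\<ge>0. u + v = 1 \<longrightarrow> (\<lambda>i. u * x i + v * y i) \<in> S)"

end

theory Submission
  imports Defs
begin

text \<open>
  The counterexample is the principal ideal of the linear form \<open>f = x + u\<^sub>1 + u\<^sub>2\<close> in
  \<open>K[x,u\<^sub>1,u\<^sub>2]\<close>, the variables \<open>u\<^sub>1\<close> and \<open>u\<^sub>2\<close> being eliminated. For every monomial order the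
  reduced Groebner basis is \<open>{f}\<close> (lemma \<open>GB_PIdl\<close>). Since \<open>f\<close> is not in \<open>K[x]\<close>, an order is an
  elimination order for this ideal exactly when the leading term of \<open>f\<close> is \<open>u\<^sub>1\<close> or \<open>u\<^sub>2\<close>. The
  Groebner cones of these two kinds of order are \<open>{\<omega>. \<omega>(u\<^sub>1) \<ge> \<omega>(x), \<omega>(u\<^sub>2)}\<close> and
  \<open>{\<omega>. \<omega>(u\<^sub>2) \<ge> \<omega>(x), \<omega>(u\<^sub>1)}\<close>, so their union is \<open>{\<omega>. max (\<omega>(u\<^sub>1)) (\<omega>(u\<^sub>2)) \<ge> \<omega>(x)}\<close>. It
  contains \<open>(2,3,0)\<close> and \<open>(2,0,3)\<close> but not their midpoint \<open>(2, 3/2, 3/2)\<close>.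

  The two inclusions are only needed in a weak form: interior points of the cones are elimination
  vectors (\<open>sum_vars_elim_vectorI\<close>), and elimination vectors satisfy the closed condition on the
  maximum (\<open>sum_vars_elim_vectorD\<close>). Both compare initial ideals. All of these are computed by
  \<open>Idl_of_leading_forms\<close>: if one monomial \<open>m\<close> of \<open>f\<close> beats all others, then the leading forms of
  the multiples of \<open>f\<close> generate the monomial ideal of \<open>m\<close>. Monomial orders and comparison of
  weights are two instances of the same argument.
\<close>

section \<open>Monomials\<close>

lemma mons_0: "0 \<in> mons N"
  by (simp add: mons_def)

lemma mons_add: "s + t \<in> mons N" if "s \<in> mons N" "t \<in> mons N"
  using that Poly_Mapping.keys_add[of s t] by (auto simp: mons_def)

lemma mons_addD: "t \<in> mons N" if "s + t \<in> mons N"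
proof -
  have "Poly_Mapping.keys t \<subseteq> Poly_Mapping.keys (s + t)"
    by (auto simp: in_keys_iff lookup_add)
  then show ?thesis using that by (auto simp: mons_def)
qed

lemma mon_add_eq_0D: "s = 0" if "s + t = 0" for s t :: mon
proof (rule poly_mapping_eqI)
  fix k show "Poly_Mapping.lookup s k = Poly_Mapping.lookup 0 k"
    using lookup_add[of s t k] that by simp
qed

lemma keys_in_mons: "t \<in> mons N" if "p \<in> mpolys N" "t \<in> Poly_Mapping.keys p"
  using that by (auto simp: mpolys_def)

lemma single_in_mpolys: "t \<in> mons N \<Longrightarrow> Poly_Mapping.single t c \<in> mpolys N"
  by (simp add: mpolys_def)

lemma carrier_mpoly_ring: "carrier (mpoly_ring N) = mpolys N"
  and mult_mpoly_ring: "p \<otimes>\<^bsub>mpoly_ring N\<^esub> q = p * q"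
  and add_mpoly_ring: "p \<oplus>\<^bsub>mpoly_ring N\<^esub> q = p + q"
  and zero_mpoly_ring: "\<zero>\<^bsub>mpoly_ring N\<^esub> = 0"
  by (simp_all add: mpoly_ring_def)

lemmas mpoly_ring_simps = carrier_mpoly_ring mult_mpoly_ring add_mpoly_ring zero_mpoly_ring

section \<open>Monomial ideals\<close>

text \<open>
  Membership is decided monomial by monomial, so that non-membership can be read off the exponents.
\<close>

definition monomial_ideal :: "nat \<Rightarrow> mon set \<Rightarrow> 'k::field mpoly set" where
  "monomial_ideal N M =
     {p \<in> mpolys N. \<forall>t\<in>Poly_Mapping.keys p. \<exists>s\<in>M. \<exists>r. t = s + r}"

lemma monomial_ideal_ideal:
  "ideal (monomial_ideal N M :: 'k::field mpoly set) (mpoly_ring N)"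
proof -
  interpret R: cring "mpoly_ring N :: 'k mpoly ring"
    by (rule cring_mpoly_ring)
  let ?J = "monomial_ideal N M :: 'k mpoly set"
  have J: "p \<in> ?J \<longleftrightarrow> p \<in> mpolys N \<and> (\<forall>t\<in>Poly_Mapping.keys p. \<exists>s\<in>M. \<exists>r. t = s + r)" for p
    by (simp add: monomial_ideal_def)
  have mult: "a * p \<in> ?J" if "p \<in> ?J" "a \<in> mpolys N" for p a
  proof -
    have "\<exists>s\<in>M. \<exists>r. t = s + r" if t: "t \<in> Poly_Mapping.keys (a * p)" for t
    proof -
      obtain u v where uv: "t = u + v" "v \<in> Poly_Mapping.keys p"
        using t Poly_Mapping.keys_mult[of a p] by auto
      then obtain s r where "s \<in> M" "v = s + r" using \<open>p \<in> ?J\<close> by (auto simp: J)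
      then have "s \<in> M" "t = s + (r + u)" using uv by (simp_all add: algebra_simps)
      then show ?thesis by blast
    qed
    moreover have "a * p \<in> mpolys N"
      using R.m_closed[of a p] that by (simp add: mpoly_ring_simps J)
    ultimately show ?thesis by (simp add: J)
  qed
  show ?thesis
  proof (rule idealI[OF R.ring_axioms])
    show "subgroup ?J (add_monoid (mpoly_ring N))"
    proof (rule R.add.subgroupI)
      show "?J \<subseteq> carrier (mpoly_ring N)" by (auto simp: J mpoly_ring_simps)
      have "0 \<in> ?J" by (simp add: J mpolys_def)
      then show "?J \<noteq> {}" by blast
    next
      fix p assume p: "p \<in> ?J"
      then have "p \<in> carrier (mpoly_ring N)" by (simp add: J mpoly_ring_simps)
      moreover have "- p \<in> carrier (mpoly_ring N)"
        using p by (simp add: J mpoly_ring_simps mpolys_def)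
      moreover have "- p \<oplus>\<^bsub>mpoly_ring N\<^esub> p = \<zero>\<^bsub>mpoly_ring N\<^esub>"
        by (simp add: mpoly_ring_simps)
      ultimately have "\<ominus>\<^bsub>mpoly_ring N\<^esub> p = - p"
        by (metis R.minus_equality)
      then show "\<ominus>\<^bsub>mpoly_ring N\<^esub> p \<in> ?J"
        using p by (simp add: J mpolys_def)
    next
      fix p q assume "p \<in> ?J" "q \<in> ?J"
      then show "p \<oplus>\<^bsub>mpoly_ring N\<^esub> q \<in> ?J"
        using Poly_Mapping.keys_add[of p q] R.a_closed[of p q]
        by (fastforce simp: J mpoly_ring_simps)
    qed
  next
    fix p a :: "'k mpoly" assume "p \<in> ?J" "a \<in> carrier (mpoly_ring N)"
    then show "a \<otimes>\<^bsub>mpoly_ring N\<^esub> p \<in> ?J" "p \<otimes>\<^bsub>mpoly_ring N\<^esub> a \<in> ?J"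
      using mult[of p a] by (simp_all add: mpoly_ring_simps mult.commute[of p])
  qed
qed

lemma sum_monomials: "(\<Sum>t\<in>Poly_Mapping.keys p. Poly_Mapping.single t (Poly_Mapping.lookup p t)) = p"
  by (rule poly_mapping_eqI)
     (simp add: lookup_sum lookup_single when_def in_keys_iff)

lemma ideal_sum_closed:
  assumes "ideal J (mpoly_ring N)" "\<And>t. t \<in> A \<Longrightarrow> g t \<in> J"
  shows "sum g A \<in> (J :: 'k::field mpoly set)"
proof -
  interpret ideal J "mpoly_ring N" by (rule assms(1))
  have "0 \<in> J" using additive_subgroup.zero_closed[OF is_additive_subgroup] by (simp add: mpoly_ring_simps)
  moreover have "p + q \<in> J" if "p \<in> J" "q \<in> J" for p q
    using additive_subgroup.a_closed[OF is_additive_subgroup that] by (simp add: mpoly_ring_simps)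
  ultimately show ?thesis using assms(2)
    by (induction A rule: infinite_finite_induct) auto
qed

text \<open>
  This converse to minimality of a generated ideal turns an inclusion in the monomial ideal of \<open>m\<close>
  into an equality.
\<close>

lemma monomial_ideal_principal_subset:
  assumes J: "ideal J (mpoly_ring N)" and m: "m \<in> mons N"
    and c: "c \<noteq> 0" and mJ: "Poly_Mapping.single m c \<in> J"
  shows "monomial_ideal N {m} \<subseteq> (J :: 'k::field mpoly set)"
proof
  interpret J: ideal J "mpoly_ring N" by (rule J)
  fix p :: "'k mpoly" assume p: "p \<in> monomial_ideal N {m}"
  have "Poly_Mapping.single t (Poly_Mapping.lookup p t) \<in> J" if t: "t \<in> Poly_Mapping.keys p" for t
  proof -
    obtain r where r: "t = m + r" using p t by (auto simp: monomial_ideal_def)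
    have "t \<in> mons N" using p t by (auto simp: monomial_ideal_def mpolys_def)
    then have "r \<in> mons N" using r mons_addD by blast
    then have "Poly_Mapping.single r (Poly_Mapping.lookup p t / c) * Poly_Mapping.single m c \<in> J"
      using J.I_l_closed[OF mJ] by (simp add: mpoly_ring_simps single_in_mpolys)
    then show ?thesis using c r by (simp add: mult_single add.commute)
  qed
  then show "p \<in> J"
    using ideal_sum_closed[OF J, of "Poly_Mapping.keys p"] sum_monomials[of p] by metis
qed

section \<open>Dominant monomials of multiples\<close>

text \<open>
  Totality is left out so that comparison of weights, which has ties, is covered along with
  monomial orders. The equivalence also lets a summand be cancelled.
\<close>

definition translation_invariant :: "nat \<Rightarrow> (mon \<Rightarrow> mon \<Rightarrow> bool) \<Rightarrow> bool" where
  "translation_invariant N lt \<longleftrightarrow>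
     irreflp_on (mons N) lt \<and> transp_on (mons N) lt \<and>
     (\<forall>r\<in>mons N. \<forall>s\<in>mons N. \<forall>t\<in>mons N. lt (s + r) (t + r) \<longleftrightarrow> lt s t)"

definition dominant :: "(mon \<Rightarrow> mon \<Rightarrow> bool) \<Rightarrow> 'k::zero mpoly \<Rightarrow> mon \<Rightarrow> bool" where
  "dominant lt f m \<longleftrightarrow>
     m \<in> Poly_Mapping.keys f \<and> (\<forall>s\<in>Poly_Mapping.keys f. s \<noteq> m \<longrightarrow> lt s m)"

definition maximal_mons :: "(mon \<Rightarrow> mon \<Rightarrow> bool) \<Rightarrow> 'k::zero mpoly \<Rightarrow> mon set" where
  "maximal_mons lt h =
     {t \<in> Poly_Mapping.keys h. \<forall>t'\<in>Poly_Mapping.keys h. \<not> lt t t'}"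

text \<open>
  Suppose a maximal monomial \<open>t = s + m'\<close> of \<open>p * f\<close> uses some \<open>m' \<noteq> m\<close>. Then \<open>t\<close> lies below
  \<open>s + m\<close>, but \<open>s + m\<close> may cancel in the product. Replacing \<open>s\<close> by a maximal monomial \<open>a\<close> of \<open>p\<close>
  above it prevents this: any other way of writing \<open>a + m\<close> as a product of a monomial of \<open>p\<close> and one
  of \<open>f\<close> would need a monomial of \<open>p\<close> above \<open>a\<close>. So \<open>a + m\<close> survives and contradicts maximality of \<open>t\<close>.
\<close>

lemma maximal_mons_multiple:
  fixes p f :: "'k::field mpoly"
  assumes inv: "translation_invariant N lt" and p: "p \<in> mpolys N" and f: "f \<in> mpolys N"
    and m: "dominant lt f m" and t: "t \<in> maximal_mons lt (p * f)"
  shows "\<exists>r. t = m + r"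
proof (rule ccontr)
  assume no: "\<nexists>r. t = m + r"
  have tr: "transp_on (mons N) lt" and ir: "irreflp_on (mons N) lt"
    and tra: "\<And>r s t. r \<in> mons N \<Longrightarrow> s \<in> mons N \<Longrightarrow> t \<in> mons N \<Longrightarrow>
                lt (s + r) (t + r) \<longleftrightarrow> lt s t"
    using inv by (auto simp: translation_invariant_def)
  have mN: "m \<in> mons N" using m f keys_in_mons by (auto simp: dominant_def)
  obtain s m' where s: "s \<in> Poly_Mapping.keys p" and m': "m' \<in> Poly_Mapping.keys f"
    and tsm: "t = s + m'"
    using t Poly_Mapping.keys_mult[of p f] by (auto simp: maximal_mons_def)
  have sN: "s \<in> mons N" and m'N: "m' \<in> mons N"
    using s m' p f keys_in_mons by blast+
  have "m' \<noteq> m" using no tsm by (metis add.commute)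
  then have "lt m' m" using m m' by (auto simp: dominant_def)
  then have less_t: "lt t (s + m)"
    using tra[of s m' m] sN m'N mN by (simp add: tsm add.commute)
  let ?A = "{s' \<in> Poly_Mapping.keys p. s' = s \<or> lt s s'}"
  have AN: "?A \<subseteq> mons N" using p keys_in_mons by blast
  have "\<exists>a\<in>?A. \<forall>x\<in>?A. x \<noteq> a \<longrightarrow> \<not> lt a x"
  proof (rule Finite_Set.bex_max_element)
    show "asymp_on ?A lt"
    proof (rule asymp_onI)
      fix x y assume "x \<in> ?A" "y \<in> ?A" "lt x y"
      then show "\<not> lt y x"
        using AN transp_onD[OF tr, of x y x] irreflp_onD[OF ir, of x] by blast
    qed
    show "transp_on ?A lt" using AN tr by (rule transp_on_subset[rotated])
  qed (use s in auto)
  then obtain a where a: "a \<in> ?A" and amax: "\<And>x. x \<in> ?A \<Longrightarrow> x \<noteq> a \<Longrightarrow> \<not> lt a x"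
    by blast
  have aN: "a \<in> mons N" using a AN by blast
  have amax': "\<not> lt a x" if x: "x \<in> Poly_Mapping.keys p" for x
  proof
    assume ax: "lt a x"
    have xN: "x \<in> mons N" using x p keys_in_mons by blast
    have "lt s x" using a ax tr sN aN xN by (auto dest: transp_onD)
    then have "x \<in> ?A" using x by simp
    moreover have "x \<noteq> a" using ax ir aN by (auto dest: irreflp_onD)
    ultimately show False using amax ax by blast
  qed
  \<comment> \<open>Splitting off the terms at \<open>a\<close> and \<open>m\<close> isolates the only contribution to the monomial \<open>a + m\<close>.\<close>
  define q where "q = p - Poly_Mapping.single a (Poly_Mapping.lookup p a)"
  define g where "g = f - Poly_Mapping.single m (Poly_Mapping.lookup f m)"
  have keys_q: "Poly_Mapping.keys q \<subseteq> Poly_Mapping.keys p - {a}"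
    and keys_g: "Poly_Mapping.keys g \<subseteq> Poly_Mapping.keys f - {m}"
    by (auto simp: q_def g_def in_keys_iff lookup_minus lookup_single when_def split: if_splits)
  have single_mult: "Poly_Mapping.single (a + m) (Poly_Mapping.lookup p a * Poly_Mapping.lookup f m)
      = Poly_Mapping.single a (Poly_Mapping.lookup p a) * Poly_Mapping.single m (Poly_Mapping.lookup f m)"
    by (simp only: mult_single)
  have pf: "p * f = Poly_Mapping.single (a + m) (Poly_Mapping.lookup p a * Poly_Mapping.lookup f m)
              + Poly_Mapping.single a (Poly_Mapping.lookup p a) * g + q * f"
    unfolding q_def g_def single_mult by (simp only: algebra_simps)
  have "a + m \<notin> Poly_Mapping.keys (Poly_Mapping.single a (Poly_Mapping.lookup p a) * g)"
    using Poly_Mapping.keys_mult[of "Poly_Mapping.single a (Poly_Mapping.lookup p a)" g] keys_g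
    by (auto dest!: subsetD split: if_splits)
  moreover have "a + m \<notin> Poly_Mapping.keys (q * f)"
  proof
    assume "a + m \<in> Poly_Mapping.keys (q * f)"
    then obtain a' m'' where a': "a' \<in> Poly_Mapping.keys q" and m'': "m'' \<in> Poly_Mapping.keys f"
      and eq: "a + m = a' + m''"
      using Poly_Mapping.keys_mult[of q f] by auto
    have a'p: "a' \<in> Poly_Mapping.keys p" "a' \<noteq> a" using a' keys_q by auto
    then have "m'' \<noteq> m" using eq by auto
    then have "lt m'' m" using m m'' by (auto simp: dominant_def)
    moreover have a'N: "a' \<in> mons N" and "m'' \<in> mons N"
      using a'p m'' p f keys_in_mons by blast+
    ultimately have "lt (a' + m'') (a' + m)" using tra[of a' m'' m] mN by (simp add: add.commute)
    then have "lt a a'" using tra[of m a a'] eq mN aN a'N by simp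
    then show False using amax' a'p by blast
  qed
  moreover have "Poly_Mapping.lookup p a * Poly_Mapping.lookup f m \<noteq> 0"
    using a m by (auto simp: dominant_def in_keys_iff)
  ultimately have key: "a + m \<in> Poly_Mapping.keys (p * f)"
    by (simp add: pf in_keys_iff lookup_add)
  have "lt t (a + m)"
  proof (cases "a = s")
    case False
    then have "lt (s + m) (a + m)" using a tra[of m s a] mN sN aN by simp
    moreover have "t \<in> mons N" "s + m \<in> mons N" "a + m \<in> mons N"
      using tsm mons_add sN m'N mN aN by auto
    ultimately show ?thesis using less_t tr by (auto dest: transp_onD)
  qed (use less_t in simp)
  then show False using t key by (auto simp: maximal_mons_def)
qed

lemma ideal_PIdl: "f \<in> mpolys N \<Longrightarrow> ideal (PIdl\<^bsub>mpoly_ring N\<^esub> f) (mpoly_ring N)"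
  for f :: "'k::field mpoly"
  using cring.cgenideal_ideal[OF cring_mpoly_ring] by (metis carrier_mpoly_ring)

lemma PIdl_iff: "h \<in> PIdl\<^bsub>mpoly_ring N\<^esub> f \<longleftrightarrow> (\<exists>p\<in>mpolys N. h = p * f)"
  by (auto simp: cgenideal_def mpoly_ring_simps)

lemma PIdl_subset_mpolys: "f \<in> mpolys N \<Longrightarrow> PIdl\<^bsub>mpoly_ring N\<^esub> f \<subseteq> mpolys N"
  for f :: "'k::field mpoly"
  using ideal.Icarr[OF ideal_PIdl] by (auto simp: carrier_mpoly_ring)

lemma PIdl_self: "f \<in> mpolys N \<Longrightarrow> f \<in> PIdl\<^bsub>mpoly_ring N\<^esub> f"
  for f :: "'k::field mpoly"
  using ring.cgenideal_self[OF cring.axioms(1)[OF cring_mpoly_ring]]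
  by (metis carrier_mpoly_ring)

text \<open>
  The map \<open>L\<close> stands for either notion of leading form. The inclusion in the monomial ideal comes
  from \<open>maximal_mons_multiple\<close>, the other one from the leading form of \<open>f\<close> itself.
\<close>

lemma Idl_of_leading_forms:
  fixes f :: "'k::field mpoly" and L :: "'k mpoly \<Rightarrow> 'k mpoly"
  assumes inv: "translation_invariant N lt" and f: "f \<in> mpolys N" and m: "dominant lt f m"
    and L: "\<And>h. h \<in> mpolys N \<Longrightarrow> h \<noteq> 0 \<Longrightarrow> Poly_Mapping.keys (L h) \<subseteq> maximal_mons lt h"
    and Lf: "L f = Poly_Mapping.single m c" "c \<noteq> 0"
  shows "Idl\<^bsub>mpoly_ring N\<^esub> (L ` (PIdl\<^bsub>mpoly_ring N\<^esub> f - {0})) = monomial_ideal N {m}"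
proof
  interpret R: cring "mpoly_ring N :: 'k mpoly ring"
    by (rule cring_mpoly_ring)
  let ?I = "PIdl\<^bsub>mpoly_ring N\<^esub> f"
  have mono: "L ` (?I - {0}) \<subseteq> monomial_ideal N {m}"
  proof safe
    fix h assume h: "h \<in> ?I" "L h \<notin> monomial_ideal N {m}"
    have hN: "h \<in> mpolys N" using PIdl_subset_mpolys[OF f] h by auto
    obtain p where p: "p \<in> mpolys N" "h = p * f" using h(1) by (auto simp: PIdl_iff)
    show "h = 0"
    proof (rule ccontr)
      assume "h \<noteq> 0"
      then have sub: "Poly_Mapping.keys (L h) \<subseteq> maximal_mons lt h" using L hN by blast
      then have "L h \<in> mpolys N" using hN by (auto simp: maximal_mons_def mpolys_def)
      moreover have "\<exists>r. t = m + r" if "t \<in> Poly_Mapping.keys (L h)" for t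
        using maximal_mons_multiple[OF inv p(1) f m] that sub p(2) by blast
      ultimately show False using h(2) by (simp add: monomial_ideal_def)
    qed
  qed
  show "Idl\<^bsub>mpoly_ring N\<^esub> (L ` (?I - {0})) \<subseteq> monomial_ideal N {m}"
    by (rule R.genideal_minimal[OF monomial_ideal_ideal mono])
  have carr: "L ` (?I - {0}) \<subseteq> carrier (mpoly_ring N)"
    using mono by (auto simp: monomial_ideal_def carrier_mpoly_ring)
  have "f \<in> ?I - {0}" using m PIdl_self[OF f] by (auto simp: dominant_def)
  then have "Poly_Mapping.single m c \<in> Idl\<^bsub>mpoly_ring N\<^esub> (L ` (?I - {0}))"
    using R.genideal_self[OF carr] Lf(1) by force
  then show "monomial_ideal N {m} \<subseteq> Idl\<^bsub>mpoly_ring N\<^esub> (L ` (?I - {0}))"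
    using m f R.genideal_ideal[OF carr] Lf(2) keys_in_mons
    by (intro monomial_ideal_principal_subset) (auto simp: dominant_def)
qed

section \<open>Monomial orders\<close>

lemma monomial_order_asym:
  assumes "monomial_order N prec" "s \<in> mons N" "t \<in> mons N" "prec s t"
  shows "\<not> prec t s"
  using assms transp_onD[of "mons N" prec s t s] irreflp_onD[of "mons N" prec s]
  by (auto simp: monomial_order_def)

lemma monomial_order_translation_invariant:
  assumes "monomial_order N prec"
  shows "translation_invariant N prec"
proof -
  have "prec (s + r) (t + r) \<longleftrightarrow> prec s t" if N: "r \<in> mons N" "s \<in> mons N" "t \<in> mons N" for r s t
  proof
    assume l: "prec (s + r) (t + r)"
    have "s \<noteq> t" using l assms N mons_add
      by (auto simp: monomial_order_def dest: irreflp_onD)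
    moreover have "\<not> prec t s"
    proof
      assume "prec t s"
      then have "prec (t + r) (s + r)" using assms N by (auto simp: monomial_order_def)
      then show False using monomial_order_asym[OF assms _ _ l] N mons_add by blast
    qed
    ultimately show "prec s t" using assms N by (auto simp: monomial_order_def dest: totalp_onD)
  qed (use assms N in \<open>auto simp: monomial_order_def\<close>)
  then show ?thesis using assms by (auto simp: translation_invariant_def monomial_order_def)
qed

lemma dominant_unique:
  assumes ord: "monomial_order N prec" and f: "f \<in> mpolys N"
    and m: "dominant prec f m" and m': "dominant prec f m'"
  shows "m = m'"
proof (rule ccontr)
  assume "m \<noteq> m'"
  then have "prec m m'" "prec m' m" using m m' by (auto simp: dominant_def)
  moreover have "m \<in> mons N" "m' \<in> mons N"
    using m m' keys_in_mons[OF f] by (auto simp: dominant_def)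
  ultimately show False using monomial_order_asym[OF ord] by blast
qed

lemma lead_mon_eqI:
  assumes "monomial_order N prec" "f \<in> mpolys N" "dominant prec f m"
  shows "lead_mon prec f = m"
  unfolding lead_mon_def
  using assms dominant_unique[OF assms(1,2)]
  by (intro the_equality) (auto simp: dominant_def)

lemma dominant_lead_mon:
  assumes ord: "monomial_order N prec" and f: "f \<in> mpolys N" "f \<noteq> 0"
  shows "dominant prec f (lead_mon prec f)"
proof -
  have sub: "Poly_Mapping.keys f \<subseteq> mons N" using f by (simp add: mpolys_def)
  have "\<exists>m\<in>Poly_Mapping.keys f. \<forall>s\<in>Poly_Mapping.keys f. s \<noteq> m \<longrightarrow> prec s m"
  proof (rule Finite_Set.bex_greatest_element)
    show "transp_on (Poly_Mapping.keys f) prec" "totalp_on (Poly_Mapping.keys f) prec"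
      using ord sub by (auto simp: monomial_order_def intro: transp_on_subset totalp_on_subset)
  qed (use f in auto)
  then obtain m where "dominant prec f m" by (auto simp: dominant_def)
  then show ?thesis using lead_mon_eqI[OF ord f(1)] by metis
qed

lemma lead_mon_in_mons:
  assumes "monomial_order N prec" "f \<in> mpolys N" "f \<noteq> 0"
  shows "lead_mon prec f \<in> mons N"
  using dominant_lead_mon[OF assms] keys_in_mons[OF assms(2)] by (simp add: dominant_def)

lemma initial_ideal_PIdl:
  fixes f :: "'k::field mpoly"
  assumes ord: "monomial_order N prec" and f: "f \<in> mpolys N" "f \<noteq> 0"
  shows "initial_ideal N prec (PIdl\<^bsub>mpoly_ring N\<^esub> f) = monomial_ideal N {lead_mon prec f}"
  unfolding initial_ideal_def
proof (rule Idl_of_leading_forms[OF monomial_order_translation_invariant[OF ord] f(1)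
        dominant_lead_mon[OF ord f]])
  fix h :: "'k mpoly" assume h: "h \<in> mpolys N" "h \<noteq> 0"
  have d: "dominant prec h (lead_mon prec h)" by (rule dominant_lead_mon[OF ord h])
  have "\<not> prec (lead_mon prec h) t" if t: "t \<in> Poly_Mapping.keys h" for t
  proof (cases "t = lead_mon prec h")
    case True
    then show ?thesis
      using ord t keys_in_mons[OF h(1)] by (auto simp: monomial_order_def dest: irreflp_onD)
  next
    case False
    then show ?thesis
      using d t keys_in_mons[OF h(1)] monomial_order_asym[OF ord] by (auto simp: dominant_def)
  qed
  then show "Poly_Mapping.keys (lead_term prec h) \<subseteq> maximal_mons prec h"
    using d by (auto simp: lead_term_def maximal_mons_def dominant_def)
next
  show "lead_coeff prec f \<noteq> 0"
    using dominant_lead_mon[OF ord f] by (auto simp: dominant_def lead_coeff_def in_keys_iff)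
qed (simp add: lead_term_def)

text \<open>
  Because the initial ideal is generated by the single monomial \<open>m\<close>, a reduced Groebner basis can
  only consist of one element \<open>g\<close>, with leading monomial \<open>m\<close>. If \<open>g\<close> is also normed then \<open>m\<close> cancels
  in \<open>g - f\<close>, so all monomials of \<open>g - f\<close> are smaller than \<open>m\<close>; a nonzero element of the ideal has a
  leading monomial divisible by \<open>m\<close>, hence not smaller, and therefore \<open>g = f\<close>.
\<close>

lemma GB_PIdl:
  fixes f :: "'k::field mpoly"
  assumes ord: "monomial_order N prec" and f: "f \<in> mpolys N" "f \<noteq> 0"
    and lc: "lead_coeff prec f = 1"
  shows "GB N prec (PIdl\<^bsub>mpoly_ring N\<^esub> f) = {f}"
proof -
  interpret R: cring "mpoly_ring N :: 'k mpoly ring"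
    by (rule cring_mpoly_ring)
  let ?I = "PIdl\<^bsub>mpoly_ring N\<^esub> f"
  define m where "m = lead_mon prec f"
  have dm: "dominant prec f m" unfolding m_def by (rule dominant_lead_mon[OF ord f])
  then have mN: "m \<in> mons N" using f keys_in_mons by (auto simp: dominant_def)
  have ltf: "lead_term prec f = Poly_Mapping.single m 1" by (simp add: lead_term_def lc m_def)
  have ini: "initial_ideal N prec ?I = monomial_ideal N {m}"
    unfolding m_def by (rule initial_ideal_PIdl[OF ord f])
  have IN: "?I \<subseteq> mpolys N" by (rule PIdl_subset_mpolys[OF f(1)])
  have lt_in: "lead_term prec h \<in> monomial_ideal N {m}" if "h \<in> ?I" "h \<noteq> 0" for h
  proof -
    have "lead_term prec ` (?I - {0}) \<subseteq> carrier (mpoly_ring N)"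
      using lead_mon_in_mons[OF ord] IN
      by (auto simp: lead_term_def mpoly_ring_simps intro!: single_in_mpolys)
    from R.genideal_self[OF this] show ?thesis
      using that ini by (auto simp: initial_ideal_def)
  qed
  have lm_in: "\<exists>r\<in>mons N. lead_mon prec h = m + r" if h: "h \<in> ?I" "h \<noteq> 0" for h
  proof -
    have d: "lead_mon prec h \<in> Poly_Mapping.keys h"
      using dominant_lead_mon[OF ord] h IN by (auto simp: dominant_def)
    then have "lead_mon prec h \<in> Poly_Mapping.keys (lead_term prec h)"
      by (simp add: lead_term_def lead_coeff_def in_keys_iff)
    then obtain r where "lead_mon prec h = m + r"
      using lt_in[OF h] by (auto simp: monomial_ideal_def)
    moreover have "lead_mon prec h \<in> mons N" using d h IN keys_in_mons by blast
    ultimately show ?thesis using mons_addD by metis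
  qed
  have eq_f: "g = f" if g: "g \<in> ?I" "g \<noteq> 0" "lead_mon prec g = m" "lead_coeff prec g = 1" for g
  proof (rule ccontr)
    assume "g \<noteq> f"
    define h where "h = g - f"
    obtain p where p: "p \<in> mpolys N" "g = p * f" using g by (auto simp: PIdl_iff)
    have "p - 1 \<in> mpolys N"
      using p(1) Poly_Mapping.keys_diff[of p 1] mons_0 by (auto simp: mpolys_def)
    moreover have "h = (p - 1) * f" by (simp add: h_def p(2) left_diff_distrib)
    ultimately have hI: "h \<in> ?I" unfolding PIdl_iff by blast
    have h0: "h \<noteq> 0" using \<open>g \<noteq> f\<close> by (simp add: h_def)
    obtain r where r: "r \<in> mons N" "lead_mon prec h = m + r" using lm_in hI h0 by blast
    have key: "m + r \<in> Poly_Mapping.keys h"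
      using dominant_lead_mon[OF ord _ h0] hI IN r by (auto simp: dominant_def)
    have "m \<notin> Poly_Mapping.keys h"
      using g(3,4) lc by (simp add: h_def in_keys_iff lookup_minus lead_coeff_def m_def)
    then have r0: "r \<noteq> 0" using key by auto
    have dg: "dominant prec g m" using dominant_lead_mon[OF ord] g IN by auto
    have "m + r \<in> Poly_Mapping.keys g \<union> Poly_Mapping.keys f"
      using key Poly_Mapping.keys_diff[of g f] by (auto simp: h_def)
    then have "prec (m + r) m" using dm dg r0 by (auto simp: dominant_def)
    moreover have "prec (0 + m) (r + m)"
      using ord r(1) r0 mN mons_0 unfolding monomial_order_def by blast
    ultimately show False
      using monomial_order_asym[OF ord, of "m + r" m] mN r(1) mons_add by (simp add: add.commute)
  qed
  have fI: "f \<in> ?I" by (rule PIdl_self[OF f(1)])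
  show ?thesis unfolding GB_def
  proof (rule the_equality, intro conjI)
    have "Idl\<^bsub>mpoly_ring N\<^esub> {Poly_Mapping.single m (1::'k)} = monomial_ideal N {m}"
    proof
      have "Poly_Mapping.single m (1::'k) \<in> monomial_ideal N {m}"
        using lt_in[OF fI f(2)] by (simp add: ltf)
      then show "Idl\<^bsub>mpoly_ring N\<^esub> {Poly_Mapping.single m (1::'k)} \<subseteq> monomial_ideal N {m}"
        by (intro R.genideal_minimal monomial_ideal_ideal) simp
      have "Poly_Mapping.single m (1::'k) \<in> carrier (mpoly_ring N)"
        using mN by (simp add: mpoly_ring_simps single_in_mpolys)
      then show "monomial_ideal N {m} \<subseteq> Idl\<^bsub>mpoly_ring N\<^esub> {Poly_Mapping.single m (1::'k)}"
        using mN R.genideal_self' R.genideal_ideal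
        by (intro monomial_ideal_principal_subset[where c = 1]) auto
    qed
    then show "groebner_basis N prec ?I {f}"
      using fI f(2) by (simp add: groebner_basis_def ini ltf)
    show "reduced prec {f}" by (simp add: reduced_def)
    show "normed prec {f}" by (simp add: normed_def lc)
  next
    fix G assume G: "groebner_basis N prec ?I G \<and> reduced prec G \<and> normed prec G"
    then have GI: "G \<subseteq> ?I - {0}" and Idl: "Idl\<^bsub>mpoly_ring N\<^esub> (lead_term prec ` G) = monomial_ideal N {m}"
      and red: "reduced prec G" and nor: "normed prec G"
      by (auto simp: groebner_basis_def ini)
    have keyG: "lead_mon prec g \<in> Poly_Mapping.keys g" if "g \<in> G" for g
      using that dominant_lead_mon[OF ord] GI IN by (auto simp: dominant_def)
    have "lead_term prec ` G \<subseteq> monomial_ideal N (lead_mon prec ` G)"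
    proof
      fix q assume "q \<in> lead_term prec ` G"
      then obtain g where g: "g \<in> G" "q = lead_term prec g" by blast
      have "lead_mon prec g \<in> mons N" using lead_mon_in_mons[OF ord] g(1) GI IN by blast
      then have "q \<in> mpolys N" by (simp add: g(2) lead_term_def single_in_mpolys)
      moreover have "\<exists>s\<in>lead_mon prec ` G. \<exists>r. t = s + r" if "t \<in> Poly_Mapping.keys q" for t
      proof -
        have "t = lead_mon prec g + 0" using that g(2) by (simp add: lead_term_def split: if_splits)
        then show ?thesis using g(1) by blast
      qed
      ultimately show "q \<in> monomial_ideal N (lead_mon prec ` G)"
        by (simp add: monomial_ideal_def)
    qed
    then have "Idl\<^bsub>mpoly_ring N\<^esub> (lead_term prec ` G) \<subseteq> monomial_ideal N (lead_mon prec ` G)"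
      by (intro R.genideal_minimal monomial_ideal_ideal)
    then have "Poly_Mapping.single m 1 \<in> (monomial_ideal N (lead_mon prec ` G) :: 'k mpoly set)"
      using lt_in[OF fI f(2)] ltf Idl by auto
    then obtain g r where g: "g \<in> G" "m = lead_mon prec g + r"
      by (auto simp: monomial_ideal_def)
    \<comment> \<open>The leading monomial of \<open>g\<close> divides \<open>m\<close> and is divisible by it.\<close>
    obtain s where s: "lead_mon prec g = m + s" using lm_in g(1) GI by blast
    have "m + s + r = m" using g(2)[unfolded s] by (rule sym)
    then have "m + (s + r) = m" by (simp only: add.assoc)
    then have "s + r = 0" by simp
    then have "s = 0" by (rule mon_add_eq_0D)
    then have lmg: "lead_mon prec g = m" using s by simp
    have lcg: "lead_coeff prec g = 1" using nor g(1) by (simp add: normed_def)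
    have "h = g" if h: "h \<in> G" for h
    proof (rule ccontr)
      assume "h \<noteq> g"
      obtain s where s: "lead_mon prec h = m + s" using lm_in h GI by blast
      have "lead_term prec g * Poly_Mapping.single s 1 = Poly_Mapping.single (lead_mon prec h) 1"
        by (simp add: lead_term_def lmg lcg s mult_single)
      then have "lead_term prec g dvd Poly_Mapping.single (lead_mon prec h) 1"
        by (metis dvd_triv_left)
      then show False using red g(1) h \<open>h \<noteq> g\<close> keyG[OF h] by (auto simp: reduced_def)
    qed
    moreover have "g = f" using eq_f[of g] g(1) GI lmg lcg by auto
    ultimately show "G = {f}" using g(1) by blast
  qed
qed

section \<open>Weight vectors\<close>

lemma mon_weight_add: "mon_weight N \<omega> (s + t) = mon_weight N \<omega> s + mon_weight N \<omega> t"
  by (simp add: mon_weight_def lookup_add algebra_simps sum.distrib)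

lemma weight_translation_invariant:
  "translation_invariant N (\<lambda>s t. mon_weight N \<omega> s < mon_weight N \<omega> t)"
  by (auto simp: translation_invariant_def mon_weight_add intro!: irreflp_onI transp_onI)

lemma weight_lead_dominant:
  assumes d: "dominant (\<lambda>s t. mon_weight N \<omega> s < mon_weight N \<omega> t) f m"
  shows "weight_lead N \<omega> f = Poly_Mapping.single m (Poly_Mapping.lookup f m)"
proof -
  have "weight_deg N \<omega> f = mon_weight N \<omega> m"
    unfolding weight_deg_def using d by (intro Max_eqI) (force simp: dominant_def)+
  then have "{t \<in> Poly_Mapping.keys f. mon_weight N \<omega> t = weight_deg N \<omega> f} = {m}"
    using d by (force simp: dominant_def)
  then show ?thesis by (simp add: weight_lead_def)
qed

lemma weight_initial_ideal_PIdl: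
  fixes f :: "'k::field mpoly"
  assumes f: "f \<in> mpolys N" and d: "dominant (\<lambda>s t. mon_weight N \<omega> s < mon_weight N \<omega> t) f m"
  shows "weight_initial_ideal N \<omega> (PIdl\<^bsub>mpoly_ring N\<^esub> f) = monomial_ideal N {m}"
  unfolding weight_initial_ideal_def
proof (rule Idl_of_leading_forms[OF weight_translation_invariant f d])
  fix h :: "'k mpoly"
  have "mon_weight N \<omega> t \<le> weight_deg N \<omega> h" if "t \<in> Poly_Mapping.keys h" for t
    using that by (simp add: weight_deg_def)
  moreover have "Poly_Mapping.keys (weight_lead N \<omega> h)
      \<subseteq> {t \<in> Poly_Mapping.keys h. mon_weight N \<omega> t = weight_deg N \<omega> h}"
    unfolding weight_lead_def
    using Poly_Mapping.keys_sum by (fastforce split: if_splits)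
  ultimately show "Poly_Mapping.keys (weight_lead N \<omega> h)
      \<subseteq> maximal_mons (\<lambda>s t. mon_weight N \<omega> s < mon_weight N \<omega> t) h"
    by (fastforce simp: maximal_mons_def)
next
  show "Poly_Mapping.lookup f m \<noteq> 0" using d by (simp add: dominant_def in_keys_iff)
qed (rule weight_lead_dominant[OF d])

section \<open>Orders with a prescribed largest variable\<close>

text \<open>
  An elimination order with leading term \<open>u\<^sub>1\<close> and one with leading term \<open>u\<^sub>2\<close> have to be exhibited.
  Ties in the exponent of the chosen variable are broken by the lexicographic order that is the
  default order on finitely supported maps.
\<close>

definition var_first_order :: "nat \<Rightarrow> mon \<Rightarrow> mon \<Rightarrow> bool" where
  "var_first_order k s t \<longleftrightarrow> Poly_Mapping.lookup s k < Poly_Mapping.lookup t k \<or> Poly_Mapping.lookup s k = Poly_Mapping.lookup t k \<and> s < t"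

lemma monomial_order_var_first: "monomial_order N (var_first_order k)"
proof -
  have pos: "0 < t" if "t \<noteq> 0" for t :: mon
  proof (rule ccontr)
    assume "\<not> 0 < t"
    then have "t < 0" using that by auto
    then show False by (simp add: less_poly_mapping.rep_eq less_fun_def)
  qed
  show ?thesis
    unfolding monomial_order_def var_first_order_def
    by (auto simp: lookup_add pos intro!: irreflp_onI transp_onI totalp_onI)
qed

section \<open>The linear form \<open>x + u\<^sub>1 + u\<^sub>2\<close>\<close>

definition var :: "nat \<Rightarrow> mon" where
  "var i = Poly_Mapping.single i 1"

lemma var_inject [simp]: "var i = var j \<longleftrightarrow> i = j"
proof
  assume "var i = var j"
  then have "Poly_Mapping.keys (var i) = Poly_Mapping.keys (var j)" by simp
  then show "i = j" by (simp add: var_def)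
qed simp

lemma lookup_var: "Poly_Mapping.lookup (var i) j = (if j = i then 1 else 0)"
  by (simp add: var_def lookup_single when_def)

lemma mon_weight_var:
  assumes "i < N"
  shows "mon_weight N \<omega> (var i) = \<omega> i"
proof -
  have "mon_weight N \<omega> (var i) = (\<Sum>j<N. if j = i then \<omega> j else 0)"
    unfolding mon_weight_def by (rule sum.cong) (auto simp: lookup_var)
  then show ?thesis using assms by simp
qed

lemma var_not_multiple: "var i \<noteq> var j + r" if "i \<noteq> j"
proof
  assume "var i = var j + r"
  then have "Poly_Mapping.lookup (var i) j = Poly_Mapping.lookup (var j) j + Poly_Mapping.lookup r j" by (simp add: lookup_add)
  then show False using that by (simp add: lookup_var)
qed

definition sum_vars :: "'k::field mpoly" where
  "sum_vars = (\<Sum>i<3. Poly_Mapping.single (var i) 1)"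

lemma lookup_sum_vars: "Poly_Mapping.lookup (sum_vars :: 'k::field mpoly) t = (if t \<in> var ` {..<3} then 1 else 0)"
proof -
  have "Poly_Mapping.lookup (sum_vars :: 'k mpoly) t = (\<Sum>i<3. if var i = t then 1 else 0)"
    by (simp add: sum_vars_def lookup_sum lookup_single when_def)
  also have "\<dots> = (if t \<in> var ` {..<3} then 1 else 0)"
  proof (cases "t \<in> var ` {..<3}")
    case True
    then obtain i where "i < 3" "t = var i" by auto
    then show ?thesis by simp
  next
    case False
    then show ?thesis by (auto intro!: sum.neutral)
  qed
  finally show ?thesis .
qed

lemma keys_sum_vars: "Poly_Mapping.keys (sum_vars :: 'k::field mpoly) = var ` {..<3}"
  by (auto simp: in_keys_iff lookup_sum_vars split: if_splits)

lemma sum_vars_in_mpolys: "sum_vars \<in> mpolys 3"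
  by (auto simp: mpolys_def mons_def keys_sum_vars var_def)

lemma sum_vars_nonzero: "(sum_vars :: 'k::field mpoly) \<noteq> 0"
proof -
  have "var 0 \<in> Poly_Mapping.keys (sum_vars :: 'k mpoly)" by (simp add: keys_sum_vars)
  then show ?thesis by auto
qed

lemma one_plus_two: "1 + 2 = (3 :: nat)"
  by simp

abbreviation sum_ideal :: "'k::field mpoly set" where
  "sum_ideal \<equiv> PIdl\<^bsub>mpoly_ring 3\<^esub> sum_vars"

lemma lead_mon_sum_vars:
  assumes ord: "monomial_order 3 prec"
  obtains k where "k < 3" "lead_mon prec (sum_vars :: 'k::field mpoly) = var k"
    "lead_term prec (sum_vars :: 'k mpoly) = Poly_Mapping.single (var k) 1"
    "GB 3 prec (sum_ideal :: 'k mpoly set) = {sum_vars}"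
proof -
  have "dominant prec (sum_vars :: 'k mpoly) (lead_mon prec (sum_vars :: 'k mpoly))"
    by (rule dominant_lead_mon[OF ord sum_vars_in_mpolys sum_vars_nonzero])
  then have "lead_mon prec (sum_vars :: 'k mpoly) \<in> var ` {..<3}"
    by (simp add: dominant_def keys_sum_vars)
  then obtain k where k: "k < 3" "lead_mon prec (sum_vars :: 'k mpoly) = var k" by auto
  then have lc: "lead_coeff prec (sum_vars :: 'k mpoly) = 1"
    by (simp add: lead_coeff_def lookup_sum_vars)
  show ?thesis
    using that k lc GB_PIdl[OF ord sum_vars_in_mpolys sum_vars_nonzero lc]
    by (simp add: lead_term_def)
qed

lemma sum_vars_weight_initial:
  assumes k: "k < 3" and dom: "\<And>i. i < 3 \<Longrightarrow> i \<noteq> k \<Longrightarrow> \<omega> i < \<omega> k"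
  shows "weight_initial_ideal 3 \<omega> sum_ideal = (monomial_ideal 3 {var k} :: 'k::field mpoly set)"
  by (rule weight_initial_ideal_PIdl[OF sum_vars_in_mpolys])
     (use assms in \<open>auto simp: dominant_def keys_sum_vars mon_weight_var\<close>)

text \<open>
  A strictly largest weight on \<open>u\<^sub>1\<close> or \<open>u\<^sub>2\<close> singles out that variable as leading form of the linear
  form, just as the order putting that variable first does, so both initial ideals coincide.
\<close>

lemma sum_vars_elim_vectorI:
  assumes k: "k \<in> {1, 2}" and \<omega>: "\<omega> \<in> weights 3"
    and dom: "\<And>i. i < 3 \<Longrightarrow> i \<noteq> k \<Longrightarrow> \<omega> i < \<omega> k"
  shows "\<omega> \<in> elim_vectors 1 2 (sum_ideal :: 'k::field mpoly set)"
proof -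
  let ?prec = "var_first_order k"
  have k3: "k < 3" using k by auto
  note ord = monomial_order_var_first[of 3 k]
  have "dominant ?prec (sum_vars :: 'k mpoly) (var k)"
    using k3 by (auto simp: dominant_def keys_sum_vars var_first_order_def lookup_var)
  then have lm: "lead_mon ?prec (sum_vars :: 'k mpoly) = var k"
    by (rule lead_mon_eqI[OF ord sum_vars_in_mpolys])
  have "elim_order 1 2 (sum_ideal :: 'k mpoly set) ?prec"
  proof -
    obtain j where j: "lead_mon ?prec (sum_vars :: 'k mpoly) = var j"
      "lead_term ?prec (sum_vars :: 'k mpoly) = Poly_Mapping.single (var j) 1"
      and gb: "GB 3 ?prec (sum_ideal :: 'k mpoly set) = {sum_vars}"
      by (rule lead_mon_sum_vars[OF ord])
    have "lead_term ?prec (sum_vars :: 'k mpoly) \<notin> mpolys 1"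
    proof -
      have "j = k" using j(1) lm by simp
      then show ?thesis using j(2) k by (auto simp: mpolys_def mons_def var_def)
    qed
    then show ?thesis using gb ord unfolding elim_order_def one_plus_two by simp
  qed
  moreover have "\<omega> \<in> groebner_cone 3 ?prec (sum_ideal :: 'k mpoly set)"
  proof -
    have "weight_initial_ideal 3 \<omega> (sum_ideal :: 'k mpoly set) = initial_ideal 3 ?prec sum_ideal"
      using sum_vars_weight_initial[where 'k = 'k and \<omega> = \<omega>, OF k3 dom]
        initial_ideal_PIdl[where 'k = 'k, OF ord sum_vars_in_mpolys sum_vars_nonzero] lm by simp
    then show ?thesis
      unfolding groebner_cone_def using \<omega>
      by (intro subsetD[OF closure_of_subset]) (auto simp: weights_def)
  qed
  ultimately show ?thesis using \<omega> unfolding elim_vectors_def one_plus_two by blast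
qed

text \<open>
  An elimination order has leading term \<open>u\<^sub>1\<close> or \<open>u\<^sub>2\<close>, so its initial ideal does not contain \<open>x\<close>.
  A weight strictly largest on \<open>x\<close> puts \<open>x\<close> in the initial ideal, and the set of such weights is
  open; hence it misses the cone even after taking the closure.
\<close>

lemma sum_vars_elim_vectorD:
  assumes "\<omega> \<in> elim_vectors 1 2 (sum_ideal :: 'k::field mpoly set)"
  shows "\<omega> 0 \<le> \<omega> 1 \<or> \<omega> 0 \<le> \<omega> 2"
proof -
  obtain prec where el: "elim_order 1 2 (sum_ideal :: 'k mpoly set) prec"
    and cone: "\<omega> \<in> groebner_cone 3 prec (sum_ideal :: 'k mpoly set)"
    using assms unfolding elim_vectors_def one_plus_two by blast
  have ord: "monomial_order 3 prec"
    and imp: "\<And>g. g \<in> GB 3 prec (sum_ideal :: 'k mpoly set) \<Longrightarrow>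
                lead_term prec g \<in> mpolys 1 \<Longrightarrow> g \<in> mpolys 1"
    using el unfolding elim_order_def one_plus_two by blast+
  obtain k where k: "k < 3" and lm: "lead_mon prec (sum_vars :: 'k mpoly) = var k"
    and ltm: "lead_term prec (sum_vars :: 'k mpoly) = Poly_Mapping.single (var k) 1"
    and gb: "GB 3 prec (sum_ideal :: 'k mpoly set) = {sum_vars}"
    by (rule lead_mon_sum_vars[OF ord])
  have "k \<noteq> 0"
  proof
    assume "k = 0"
    then have "lead_term prec (sum_vars :: 'k mpoly) \<in> mpolys 1"
      by (simp add: ltm mpolys_def mons_def var_def)
    then have "(sum_vars :: 'k mpoly) \<in> mpolys 1" using imp gb by simp
    moreover have "var 1 \<in> Poly_Mapping.keys (sum_vars :: 'k mpoly)" by (simp add: keys_sum_vars)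
    ultimately have "var 1 \<in> mons 1" by (rule keys_in_mons)
    then show False by (simp add: mons_def var_def)
  qed
  have ini: "initial_ideal 3 prec (sum_ideal :: 'k mpoly set) = monomial_ideal 3 {var k}"
    using initial_ideal_PIdl[where 'k = 'k, OF ord sum_vars_in_mpolys sum_vars_nonzero] lm by simp
  let ?T = "{\<omega> \<in> topspace (Euclidean_space 3). \<omega> 0 \<le> max (\<omega> 1) (\<omega> 2)}"
  have "groebner_cone 3 prec (sum_ideal :: 'k mpoly set) \<subseteq> ?T"
    unfolding groebner_cone_def
  proof (rule closure_of_minimal, safe)
    fix \<omega> assume w: "\<omega> \<in> weights 3"
      and eq: "weight_initial_ideal 3 \<omega> (sum_ideal :: 'k mpoly set) = initial_ideal 3 prec sum_ideal"
    show "\<omega> \<in> topspace (Euclidean_space 3)" using w by (simp add: weights_def)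
    show "\<omega> 0 \<le> max (\<omega> 1) (\<omega> 2)"
    proof (rule ccontr)
      assume "\<not> ?thesis"
      then have "\<omega> i < \<omega> 0" if "i < 3" "i \<noteq> 0" for i
        using that by (auto simp: numeral_3_eq_3 less_Suc_eq numeral_2_eq_2)
      then have "(monomial_ideal 3 {var 0} :: 'k mpoly set) = monomial_ideal 3 {var k}"
        using sum_vars_weight_initial[of 0 \<omega>, where 'k = 'k] eq ini by simp
      moreover have "Poly_Mapping.single (var 0) 1 \<in> (monomial_ideal 3 {var 0} :: 'k mpoly set)"
        by (auto simp: monomial_ideal_def mpolys_def mons_def var_def intro!: exI[of _ 0])
      ultimately have "Poly_Mapping.single (var 0) 1 \<in> (monomial_ideal 3 {var k} :: 'k mpoly set)"
        by simp
      then show False using var_not_multiple[of 0 k] \<open>k \<noteq> 0\<close> by (auto simp: monomial_ideal_def)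
    qed
  next
    have "closed {\<omega> :: nat \<Rightarrow> real. \<omega> 0 \<le> max (\<omega> 1) (\<omega> 2)}"
      by (intro closed_Collect_le continuous_on_max continuous_on_product_coordinates)
    moreover have "closed (topspace (Euclidean_space 3))"
      using closedin_Euclidean_space_iff closedin_topspace by blast
    ultimately have "closed ?T"
      using closed_Int[of "topspace (Euclidean_space 3)" "{\<omega>. \<omega> 0 \<le> max (\<omega> 1) (\<omega> 2)}"]
      by (simp add: Collect_conj_eq)
    then show "closedin (Euclidean_space 3) ?T"
      by (simp add: closedin_Euclidean_space_iff)
  qed
  then show ?thesis using cone by (auto simp: max_def split: if_splits)
qed

theorem mainTheorem3:
  shows "\<exists>n m (I :: 'k::field mpoly set).
           n \<ge> 1 \<and> m \<ge> 1 \<and> ideal I (mpoly_ring (n + m)) \<and> \<not> convex_fun (elim_vectors n m I)"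
proof -
  let ?E = "elim_vectors 1 2 (sum_ideal :: 'k mpoly set)"
  \<comment> \<open>The weight \<open>2\<close> of \<open>x\<close> lies below \<open>3\<close> but above the average \<open>3/2\<close> of \<open>3\<close> and \<open>0\<close>.\<close>
  define a b :: "nat \<Rightarrow> real"
    where "a = (\<lambda>i. if i = 0 then 2 else if i = 1 then 3 else 0)"
      and "b = (\<lambda>i. if i = 0 then 2 else if i = 2 then 3 else 0)"
  have "a \<in> ?E"
    by (rule sum_vars_elim_vectorI[of 1])
       (auto simp: a_def weights_def topspace_Euclidean_space)
  moreover have "b \<in> ?E"
    by (rule sum_vars_elim_vectorI[of 2])
       (auto simp: b_def weights_def topspace_Euclidean_space)
  moreover have "(\<lambda>i. (1/2) * a i + (1/2) * b i) \<notin> ?E"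
    using sum_vars_elim_vectorD[where 'k = 'k and \<omega> = "\<lambda>i. (1/2) * a i + (1/2) * b i"]
    by (auto simp: a_def b_def)
  moreover have "(\<lambda>i. (1/2) * a i + (1/2) * b i) \<in> ?E" if "convex_fun ?E" "a \<in> ?E" "b \<in> ?E"
    using that(1)[unfolded convex_fun_def, rule_format, OF that(2,3), of "1/2" "1/2"] by simp
  ultimately have "\<not> convex_fun ?E" by blast
  moreover have "ideal (sum_ideal :: 'k mpoly set) (mpoly_ring (1 + 2))"
    unfolding one_plus_two by (rule ideal_PIdl[OF sum_vars_in_mpolys])
  ultimately show ?thesis
    by (intro exI[of _ 1] exI[of _ 2] exI[of _ sum_ideal] conjI) auto
qed

end
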